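(* Let $\mathcal{A}\in\mathbb{R}^{n\times n\times p}$ be T-SPD, $d=np$, with T-eigenvalues $\lambda_1\ge\lambda_2\ge\cdots\ge\lambda_d>0$, and let $\mathbf{v}_1$ be a unit eigenvector of $\operatorname{bcirc}(\mathcal{A})$ for $\lambda_1$. For $q\ge 1$ let $\hat\lambda_1^{\rm pow}$ be the Rayleigh quotient produced by the T-product randomized power method after $q$ iterations from the random initial vector $\mathbf{x}_0$, let $\theta_0\in[0,\pi/2]$ be the angle between $\mathbf{x}_0$ and $\mathbf{v}_1$, and let $\hat\lambda_1^{\rm TDep}:=m+s\sqrt{d-1}$. (i) (Lower-endpoint tightening) Under the generic hypothesis $\cos\theta_0\ne 0$ (which holds almost surely under Gaussian initialisation), $\hat\lambda_1^{\rm pow}\to\lambda_1$ as $q\to\infty$, with exponential rate governed by the spectral gap $\gamma=1-\lambda_2/\lambda_1$. (ii) (Upper-endpoint sharpness) $\hat\lambda_1^{\rm TDep}=\lambda_1$ if and only if $\lambda_2=\lambda_3=\cdots=\lambda_d$. (iii) (Simultaneous sharpness) The bracket width $\hat\lambda_1^{\rm TDep}-\hat\lambda_1^{\rm pow}$ tends to zero as $q\to\infty$ if and only if $\lambda_2=\cdots=\lambda_d$, at which point both endpoints agree with $\lambda_1$ in the limit. For any finite $q$ the bracket has strictly positive width almost surely: the event $\{\mathbf{x}_0\in\operatorname{span}(\mathbf{v}_1)\}$ has Lebesgue measure zero on the unit sphere in $\mathbb{R}^d$.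
   Context: For $\mathcal{A}\in\mathbb{R}^{n\times n\times p}$ with frontal slices $\mathcal{A}^{(1)},\dots,\mathcal{A}^{(p)}\in\mathbb{R}^{n\times n}$, $\operatorname{bcirc}(\mathcal{A})\in\mathbb{R}^{np\times np}$ is the block circulant matrix whose $(i,j)$ block ($1\le i,j\le p$) is $\mathcal{A}^{(((i-j)\bmod p)+1)}$. The tensor $\mathcal{A}$ is T-SPD if $\operatorname{bcirc}(\mathcal{A})$ is symmetric positive definite. The T-eigenvalues of $\mathcal{A}$ are the eigenvalues of $\operatorname{bcirc}(\mathcal{A})$, counted with multiplicity. The mean and standard deviation of the spectrum are $m=\frac1d\sum_{i=1}^d\lambda_i$ and $s=\bigl(\frac1d\sum_{i=1}^d\lambda_i^2-m^2\bigr)^{1/2}\ge 0$. T-product randomized power method with $q$ iterations: draw $\mathbf{x}_0\sim\mathcal{N}(0,I_d)$ and normalize it to unit Euclidean norm (this normalized vector is again called $\mathbf{x}_0$); for $k=1,\dots,q$ set $\mathbf{y}_k=\operatorname{bcirc}(\mathcal{A})\mathbf{x}_{k-1}$ and $\mathbf{x}_k=\mathbf{y}_k/\|\mathbf{y}_k\|_2$; output $\hat\lambda_1^{\rm pow}=\mathbf{x}_q^{\mathsf T}\operatorname{bcirc}(\mathcal{A})\mathbf{x}_q$. The bracket is the interval $[\hat\lambda_1^{\rm pow},\hat\lambda_1^{\rm TDep}]$.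
   Formalization: The width equivalence in (iii) is stated under cos θ₀ ≠ 0; almost-sure positive width assumes the λᵢ are not all equal (false for bcirc(A)=cI); the rate in (i) and the measure-zero claim for span(v₁) are stated for d ≥ 2 (for d=1, λ₂ is undefined and the sphere is {±v₁}). *)

theory Defs
  imports "HOL-Probability.Probability" "Jordan_Normal_Form.Char_Poly"
begin

unbundle no vec_syntax and no inner_syntax

text \<open>Vectors and matrices are those of \<^theory>\<open>Jordan_Normal_Form.Matrix\<close>, whose entries are indexed
  from 0. Frontal slices and eigenvalues are indexed from 1.\<close>

definition norm2 :: "real vec \<Rightarrow> real" where
  "norm2 x = sqrt (x \<bullet> x)"

definition normalize_vec :: "real vec \<Rightarrow> real vec" where
  "normalize_vec x = (1 / norm2 x) \<cdot>\<^sub>v x"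

definition unit_sphere :: "nat \<Rightarrow> real vec set" where
  "unit_sphere d = {x \<in> carrier_vec d. norm2 x = 1}"

text \<open>The angle in \<open>[0, \<pi>/2]\<close>, that is, the angle between the lines spanned by the two vectors.\<close>

definition angle :: "real vec \<Rightarrow> real vec \<Rightarrow> real" where
  "angle x v = arccos (\<bar>x \<bullet> v\<bar> / (norm2 x * norm2 v))"

definition spd :: "real mat \<Rightarrow> bool" where
  "spd M \<longleftrightarrow> M \<in> carrier_mat (dim_row M) (dim_row M) \<and> transpose_mat M = M \<and>
    (\<forall>x \<in> carrier_vec (dim_row M). x \<noteq> 0\<^sub>v (dim_row M) \<longrightarrow> 0 < x \<bullet> (M *\<^sub>v x))"

text \<open>A tensor in \<open>\<real>\<^bsup>n \<times> n \<times> p\<^esup>\<close> is given by its frontal slices \<open>A 1, \<dots>, A p\<close>. The subtraction of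
  block indices is on integers, so that \<open>mod\<close> yields the representative in \<open>{0..<p}\<close>.\<close>

definition bcirc :: "nat \<Rightarrow> nat \<Rightarrow> (nat \<Rightarrow> real mat) \<Rightarrow> real mat" where
  "bcirc n p A = mat (n * p) (n * p) (\<lambda>(r, c).
     A (nat ((int (r div n) - int (c div n)) mod int p) + 1) $$ (r mod n, c mod n))"

definition T_SPD :: "nat \<Rightarrow> nat \<Rightarrow> (nat \<Rightarrow> real mat) \<Rightarrow> bool" where
  "T_SPD n p A \<longleftrightarrow> spd (bcirc n p A)"

text \<open>\<open>\<lambda>\<^sub>1, \<dots>, \<lambda>\<^sub>d\<close> with \<open>d = np\<close> enumerate the eigenvalues of \<open>bcirc(A)\<close> with multiplicity.\<close>

definition T_eigenvalues :: "nat \<Rightarrow> nat \<Rightarrow> (nat \<Rightarrow> real mat) \<Rightarrow> (nat \<Rightarrow> real) \<Rightarrow> bool" where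
  "T_eigenvalues n p A lam \<longleftrightarrow> char_poly (bcirc n p A) = (\<Prod>i = 1..n * p. [:- lam i, 1:])"

definition spec_mean :: "nat \<Rightarrow> (nat \<Rightarrow> real) \<Rightarrow> real" where
  "spec_mean d lam = (1 / real d) * (\<Sum>i = 1..d. lam i)"

definition spec_sd :: "nat \<Rightarrow> (nat \<Rightarrow> real) \<Rightarrow> real" where
  "spec_sd d lam = sqrt ((1 / real d) * (\<Sum>i = 1..d. (lam i)\<^sup>2) - (spec_mean d lam)\<^sup>2)"

definition lam_TDep :: "nat \<Rightarrow> (nat \<Rightarrow> real) \<Rightarrow> real" where
  "lam_TDep d lam = spec_mean d lam + spec_sd d lam * sqrt (real d - 1)"

definition spectral_gap :: "(nat \<Rightarrow> real) \<Rightarrow> real" where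
  "spectral_gap lam = 1 - lam 2 / lam 1"

primrec power_iterate :: "real mat \<Rightarrow> real vec \<Rightarrow> nat \<Rightarrow> real vec" where
  "power_iterate M x0 0 = x0"
| "power_iterate M x0 (Suc k) = normalize_vec (M *\<^sub>v power_iterate M x0 k)"

text \<open>Here \<open>x0\<close> is the initial vector after normalization to unit norm.\<close>

definition lam_pow :: "nat \<Rightarrow> nat \<Rightarrow> (nat \<Rightarrow> real mat) \<Rightarrow> real vec \<Rightarrow> nat \<Rightarrow> real" where
  "lam_pow n p A x0 q =
     power_iterate (bcirc n p A) x0 q \<bullet> (bcirc n p A *\<^sub>v power_iterate (bcirc n p A) x0 q)"

text \<open>Borel sets, Lebesgue measure and the law \<open>N(0, I\<^sub>d)\<close> on \<open>\<real>\<^sup>d\<close>, transported from the product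
  measure spaces on functions \<open>{..<d} \<rightarrow> \<real>\<close>.\<close>

definition borel_vec :: "nat \<Rightarrow> real vec measure" where
  "borel_vec d = vimage_algebra (carrier_vec d) (\<lambda>v. \<lambda>i\<in>{..<d}. v $ i) (\<Pi>\<^sub>M i\<in>{..<d}. borel)"

definition lborel_vec :: "nat \<Rightarrow> real vec measure" where
  "lborel_vec d = distr (\<Pi>\<^sub>M i\<in>{..<d}. lborel) (borel_vec d) (Matrix.vec d)"

definition std_gaussian_vec :: "nat \<Rightarrow> real vec measure" where
  "std_gaussian_vec d = distr (\<Pi>\<^sub>M i\<in>{..<d}. density lborel (\<lambda>t. ennreal (std_normal_density t)))
     (borel_vec d) (Matrix.vec d)"

text \<open>Lebesgue (surface) measure on the unit sphere, by polar coordinates: the measure of \<open>E\<close> is \<open>d\<close>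
  times the volume of the truncated cone \<open>{r x | 0 < r \<le> 1, x \<in> E}\<close>.\<close>

definition sphere_measure :: "nat \<Rightarrow> real vec measure" where
  "sphere_measure d = scale_measure (of_nat d)
     (distr (restrict_space (lborel_vec d) {x. x \<noteq> 0\<^sub>v d \<and> norm2 x \<le> 1})
       (restrict_space (borel_vec d) (unit_sphere d)) normalize_vec)"

end

theory Submission
  imports Defs
begin

text \<open>In an orthonormal eigenbasis whose first vector is \<open>v1\<close>, the \<open>q\<close>-th power iterate has coordinates
  \<open>\<kappa> * \<lambda>\<^sub>i ^ q * c\<^sub>i\<close>, where \<open>c\<^sub>i\<close> are the coordinates of \<open>x0\<close> and \<open>\<kappa>\<close> normalizes. Hence
  \<open>\<lambda>\<^sub>1\<close> minus the Rayleigh quotient is \<open>\<kappa>\<^sup>2 * \<Sum>\<^sub>i (\<lambda>\<^sub>1 - \<lambda>\<^sub>i) * \<lambda>\<^sub>i ^ (2 * q) * c\<^sub>i\<^sup>2\<close>, a sum of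
  nonnegative terms; as the first coordinate of a unit vector is at most 1, \<open>\<kappa>\<^sup>2\<close> is at most
  \<open>1 / (\<lambda>\<^sub>1 ^ (2 * q) * c\<^sub>1\<^sup>2)\<close>. This gives convergence and the rate, and strict inequality once
  \<open>c\<^sub>k \<noteq> 0\<close> for some \<open>\<lambda>\<^sub>k < \<lambda>\<^sub>1\<close>. The exceptional sets of initial vectors lie in hyperplanes, which are
  null by Fubini. The upper endpoint is Samuelson's inequality together with its equality case.\<close>

section \<open>Orthogonal diagonalization\<close>

lemma mat_mult_unit_vec_col:
  fixes A :: "'a :: semiring_1 mat"
  assumes "A \<in> carrier_mat m n" "j < n"
  shows "A *\<^sub>v unit_vec n j = col A j"
  by (rule eq_vecI) (use assms in \<open>auto simp: scalar_prod_right_unit\<close>)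

text \<open>The Householder reflection exchanging the first unit vector and \<open>v\<close>, or the
  identity if the two coincide. As a symmetric involution, \<open>H\<close> is its own transpose and
  inverse, so conjugation by it preserves symmetry and the characteristic polynomial.\<close>

lemma householder_reflection:
  fixes v :: "real vec"
  assumes v: "v \<in> carrier_vec (Suc n)" and unit: "v \<bullet> v = 1"
  obtains H where "H \<in> carrier_mat (Suc n) (Suc n)" "transpose_mat H = H"
    "H * H = 1\<^sub>m (Suc n)" "H *\<^sub>v unit_vec (Suc n) 0 = v"
proof (cases "v $ 0 = 1")
  case True
  \<comment> \<open>The first entry already has square 1, so unit length forces all other entries to
    vanish.\<close>
  have "(\<Sum>i=0..<Suc n. v $ i * v $ i) = 1"
    using unit v by (simp add: scalar_prod_def)
  hence s: "(\<Sum>i=1..<Suc n. v $ i * v $ i) = 0"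
    using True by (simp add: sum.atLeast_Suc_lessThan del: sum.op_ivl_Suc)
  have z: "v $ i = 0" if "i \<in> {1..<Suc n}" for i
    using s that by (subst (asm) sum_nonneg_eq_0_iff) auto
  have "v = unit_vec (Suc n) 0"
  proof (rule eq_vecI)
    fix i assume "i < dim_vec (unit_vec (Suc n) 0 :: real vec)"
    thus "v $ i = unit_vec (Suc n) 0 $ i" using z[of i] True by (cases "i = 0") auto
  qed (use v in auto)
  thus ?thesis by (intro that[of "1\<^sub>m (Suc n)"]) auto
next
  case False
  \<comment> \<open>Reflection in the hyperplane orthogonal to \<open>v - e\<^sub>0\<close>, whose squared norm is \<open>k\<close>.\<close>
  define u where "u i = v $ i - (if i = 0 then 1 else 0)" for i
  define k where "k = 2 - 2 * v $ 0"
  have k: "k \<noteq> 0" using False by (simp add: k_def)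
  define H where "H = Matrix.mat (Suc n) (Suc n) (\<lambda>(i,j). (if i = j then 1 else 0) - 2 * u i * u j / k)"
  have H: "H \<in> carrier_mat (Suc n) (Suc n)" by (simp add: H_def)
  have "(\<Sum>i=0..<Suc n. v $ i * v $ i) = 1"
    using unit v by (simp add: scalar_prod_def)
  hence "(\<Sum>i=1..<Suc n. v $ i * v $ i) = 1 - v $ 0 * v $ 0"
    by (simp add: sum.atLeast_Suc_lessThan del: sum.op_ivl_Suc)
  moreover have "(\<Sum>i=0..<Suc n. u i * u i) = u 0 * u 0 + (\<Sum>i=1..<Suc n. v $ i * v $ i)"
    by (simp add: sum.atLeast_Suc_lessThan u_def del: sum.op_ivl_Suc)
  ultimately have uu: "(\<Sum>i=0..<Suc n. u i * u i) = k"
    by (simp add: u_def k_def algebra_simps)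
  have u0: "u 0 = - k / 2" by (simp add: u_def k_def)
  show ?thesis
  proof (rule that[OF H])
    show "transpose_mat H = H" by (rule eq_matI) (auto simp: H_def)
    show "H * H = 1\<^sub>m (Suc n)"
    proof (rule eq_matI)
      fix i j assume ij: "i < dim_row (1\<^sub>m (Suc n) :: real mat)" "j < dim_col (1\<^sub>m (Suc n) :: real mat)"
      have "(H * H) $$ (i,j) = (\<Sum>l=0..<Suc n. ((if i = l then 1 else 0) - 2 * u i * u l / k)
          * ((if l = j then 1 else 0) - 2 * u l * u j / k))"
        using ij by (simp add: H_def scalar_prod_def)
      \<comment> \<open>The Kronecker deltas pick out \<open>l = i\<close> and \<open>l = j\<close>,
        and the quadratic term sums to \<open>k\<close> by \<open>uu\<close>, so the corrections
        with factors -2, -2 and 4 cancel.\<close>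
      also have "\<dots> = (\<Sum>l=0..<Suc n. (if l = i then (if i = j then 1 else 0) - 2 * u i * u j / k else 0)
           - (if l = j then 2 * u i * u j / k else 0) + 4 * u i * u j / (k * k) * (u l * u l))"
        by (intro sum.cong) (auto simp: algebra_simps)
      also have "\<dots> = (if i = j then 1 else 0) - 2 * u i * u j / k
          - 2 * u i * u j / k + 4 * u i * u j / (k * k) * k"
        using ij unfolding sum.distrib sum_subtractf sum_distrib_left[symmetric] uu
        by (simp del: sum.op_ivl_Suc)
      also have "\<dots> = (1\<^sub>m (Suc n) :: real mat) $$ (i,j)"
        using ij k by (auto simp: field_simps)
      finally show "(H * H) $$ (i,j) = 1\<^sub>m (Suc n) $$ (i,j)" .
    qed (auto simp: H_def)
    show "H *\<^sub>v unit_vec (Suc n) 0 = v"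
    proof (rule eq_vecI)
      fix i assume i: "i < dim_vec v"
      have "(H *\<^sub>v unit_vec (Suc n) 0) $ i = H $$ (i, 0)"
        using i v H by (simp add: mult_mat_vec_def scalar_prod_right_unit)
      \<comment> \<open>\<open>u 0 = - k / 2\<close> makes the coefficient of \<open>u i\<close> in
        column 0 equal to 1.\<close>
      also have "\<dots> = (if i = 0 then 1 else 0) + u i"
        using i v k by (auto simp: H_def u0)
      finally show "(H *\<^sub>v unit_vec (Suc n) 0) $ i = v $ i" by (simp add: u_def)
    qed (use v H in auto)
  qed
qed

text \<open>The eigenvector equation fixes the first column and symmetry the first row, so only the
  trailing block \<open>N\<close> remains to be diagonalized.\<close>

lemma symmetric_deflation:
  fixes M :: "real mat"
  assumes M: "M \<in> carrier_mat (Suc n) (Suc n)" and sym: "transpose_mat M = M"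
    and e1: "M *\<^sub>v unit_vec (Suc n) 0 = e \<cdot>\<^sub>v unit_vec (Suc n) 0"
  obtains N where "N \<in> carrier_mat n n" "transpose_mat N = N"
    "M = four_block_mat (mat 1 1 (\<lambda>_. e)) (0\<^sub>m 1 n) (0\<^sub>m n 1) N"
proof -
  define N where "N = Matrix.mat n n (\<lambda>(i,j). M $$ (Suc i, Suc j))"
  have s: "M $$ (i,j) = M $$ (j,i)" if "i < Suc n" "j < Suc n" for i j
    using that M arg_cong[OF sym, of "\<lambda>X. X $$ (i,j)"] by simp
  have c: "M $$ (i,0) = (if i = 0 then e else 0)" if "i < Suc n" for i
  proof -
    have "M $$ (i,0) = (M *\<^sub>v unit_vec (Suc n) 0) $ i"
      using that M by (simp add: mult_mat_vec_def scalar_prod_right_unit)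
    thus ?thesis using e1 that by simp
  qed
  show ?thesis
  proof (rule that[of N])
    show "transpose_mat N = N" by (rule eq_matI) (auto simp: N_def s)
    show "M = four_block_mat (mat 1 1 (\<lambda>_. e)) (0\<^sub>m 1 n) (0\<^sub>m n 1) N"
    proof (rule eq_matI)
      fix i j
      assume "i < dim_row (four_block_mat (mat 1 1 (\<lambda>_. e)) (0\<^sub>m 1 n) (0\<^sub>m n 1) N)"
        "j < dim_col (four_block_mat (mat 1 1 (\<lambda>_. e)) (0\<^sub>m 1 n) (0\<^sub>m n 1) N)"
      thus "M $$ (i,j) = four_block_mat (mat 1 1 (\<lambda>_. e)) (0\<^sub>m 1 n) (0\<^sub>m n 1) N $$ (i,j)"
        using c[of i] c[of j] s[of i j] by (cases i; cases j) (auto simp: N_def)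
    qed (use M in \<open>auto simp: N_def\<close>)
  qed (auto simp: N_def)
qed

lemma unit_eigenvector_exists:
  fixes M :: "real mat"
  assumes M: "M \<in> carrier_mat n n" and "poly (char_poly M) e = 0"
  obtains v where "v \<in> carrier_vec n" "v \<bullet> v = 1" "M *\<^sub>v v = e \<cdot>\<^sub>v v"
proof -
  obtain w where w: "w \<in> carrier_vec n" "w \<noteq> 0\<^sub>v n" "M *\<^sub>v w = e \<cdot>\<^sub>v w"
    using assms by (auto simp: eigenvalue_root_char_poly[OF M, symmetric] eigenvalue_def eigenvector_def)
  have pos: "w \<bullet> w > 0"
    using w conjugate_square_greater_0_vec[of w n] by simp
  show ?thesis
  proof (rule that[of "(1 / sqrt (w \<bullet> w)) \<cdot>\<^sub>v w"])
    show "((1 / sqrt (w \<bullet> w)) \<cdot>\<^sub>v w) \<bullet> ((1 / sqrt (w \<bullet> w)) \<cdot>\<^sub>v w) = 1"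
      using w pos by (simp add: scalar_prod_smult_distrib[OF _ w(1)])
    show "M *\<^sub>v ((1 / sqrt (w \<bullet> w)) \<cdot>\<^sub>v w) = e \<cdot>\<^sub>v ((1 / sqrt (w \<bullet> w)) \<cdot>\<^sub>v w)"
      using w M by (simp add: mult_mat_vec[OF M w(1)] smult_smult_assoc mult.commute)
  qed (use w in auto)
qed

text \<open>Induction on the eigenvalue list, splitting off one eigenvector at a time. The
  eigenvector \<open>v\<close> for the first eigenvalue is prescribed: if that eigenvalue is
  multiple, an arbitrary eigenbasis may fail to contain a given eigenvector. The guards
  \<open>0 < n\<close> accommodate the empty matrix of the base case.\<close>

lemma spectral_theorem_real_symmetric:
  fixes M :: "real mat"
  assumes "M \<in> carrier_mat n n" "transpose_mat M = M" "length es = n"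
    "char_poly M = (\<Prod>e\<leftarrow>es. [:- e, 1:])"
    "0 < n \<Longrightarrow> v \<in> carrier_vec n \<and> v \<bullet> v = 1 \<and> M *\<^sub>v v = hd es \<cdot>\<^sub>v v"
  shows "\<exists>Q \<in> carrier_mat n n. transpose_mat Q * Q = 1\<^sub>m n \<and> M * Q = Q * mat_diag n (\<lambda>i. es ! i) \<and>
    (0 < n \<longrightarrow> Q *\<^sub>v unit_vec n 0 = v)"
  using assms
proof (induction es arbitrary: n M v)
  case Nil
  thus ?case by (intro bexI[of _ "1\<^sub>m 0"]) (auto intro!: eq_matI simp: mat_diag_def)
next
  case (Cons e es n0)
  obtain n where n0: "n0 = Suc n" and len: "length es = n" using Cons.prems(3) by auto
  note M = Cons.prems(1)[unfolded n0] and sym = Cons.prems(2)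
  have v: "v \<in> carrier_vec (Suc n)" "v \<bullet> v = 1" "M *\<^sub>v v = e \<cdot>\<^sub>v v"
    using Cons.prems(5) n0 by auto
  let ?e1 = "unit_vec (Suc n) 0 :: real vec"
  obtain H where H: "H \<in> carrier_mat (Suc n) (Suc n)" "transpose_mat H = H"
    "H * H = 1\<^sub>m (Suc n)" "H *\<^sub>v ?e1 = v"
    using householder_reflection[OF v(1,2)] by metis
  define K where "K = H * (M * H)"
  have K: "K \<in> carrier_mat (Suc n) (Suc n)" using H M by (simp add: K_def)
  have Hv: "H *\<^sub>v v = ?e1"
  proof -
    have "H *\<^sub>v v = (H * H) *\<^sub>v ?e1"
      using assoc_mult_mat_vec[OF H(1) H(1), of ?e1] H(4) by simp
    thus ?thesis using H by simp
  qed
  have symK: "transpose_mat K = K"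
    using H M sym unfolding K_def by (simp add: transpose_mult[of _ "Suc n" "Suc n" _ "Suc n"] assoc_mult_mat[of _ "Suc n" "Suc n" _ "Suc n" _ "Suc n"])
  have "K *\<^sub>v ?e1 = H *\<^sub>v (M *\<^sub>v (H *\<^sub>v ?e1))"
    using H(1) M unfolding K_def
    by (simp add: assoc_mult_mat_vec[of _ "Suc n" "Suc n" _ "Suc n"])
  also have "\<dots> = e \<cdot>\<^sub>v ?e1" using H v by (simp add: mult_mat_vec[OF H(1)] Hv)
  finally obtain N where N: "N \<in> carrier_mat n n" "transpose_mat N = N"
    "K = four_block_mat (mat 1 1 (\<lambda>_. e)) (0\<^sub>m 1 n) (0\<^sub>m n 1) N"
    using symmetric_deflation[OF K symK] by metis
  \<comment> \<open>Similar matrices share the characteristic polynomial. The block form of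
    \<open>K\<close> contributes the factor \<open>[:- e, 1:]\<close>, and cancelling it leaves that
    of \<open>N\<close>.\<close>
  have "similar_mat M K"
    unfolding similar_mat_def
  proof (intro exI similar_mat_witI)
    have "H * K * H = (H * H) * M * (H * H)"
      unfolding K_def using H(1) M
      by (simp add: assoc_mult_mat[of _ "Suc n" "Suc n" _ "Suc n" _ "Suc n"])
    thus "M = H * K * H" using H(3) M by simp
  qed (use H M K in auto)
  hence "char_poly K = (\<Prod>e\<leftarrow>e # es. [:- e, 1:])"
    using Cons.prems(4) by (simp add: char_poly_similar)
  moreover have "char_poly K = char_poly (mat 1 1 (\<lambda>_. e)) * char_poly N"
    unfolding N(3) by (rule char_poly_four_block_zeros_col) (use N in auto)
  moreover have "char_poly (mat 1 1 (\<lambda>_. e)) = [:- e, 1:]"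
    by (simp add: char_poly_defs det_def sign_def)
  ultimately have cpN: "char_poly N = (\<Prod>e\<leftarrow>es. [:- e, 1:])"
    by (metis (no_types, lifting) list.simps(9) mult_cancel_left pCons_eq_0_iff prod_list.Cons zero_neq_one)
  \<comment> \<open>The induction hypothesis again wants a prescribed eigenvector; inside the block,
    any unit eigenvector for the next eigenvalue will do.\<close>
  have "\<exists>w. 0 < n \<longrightarrow> w \<in> carrier_vec n \<and> w \<bullet> w = 1 \<and> N *\<^sub>v w = hd es \<cdot>\<^sub>v w"
  proof (cases es)
    case Nil thus ?thesis using len by simp
  next
    case (Cons a list)
    hence "poly (char_poly N) (hd es) = 0" by (simp add: cpN)
    thus ?thesis using unit_eigenvector_exists[OF N(1)] by metis
  qed
  then obtain w where w: "0 < n \<Longrightarrow> w \<in> carrier_vec n \<and> w \<bullet> w = 1 \<and> N *\<^sub>v w = hd es \<cdot>\<^sub>v w" by blast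
  obtain P where P: "P \<in> carrier_mat n n" "transpose_mat P * P = 1\<^sub>m n"
    "N * P = P * mat_diag n (\<lambda>i. es ! i)"
    using Cons.IH[OF N(1,2) len cpN w] by blast
  \<comment> \<open>\<open>B\<close> extends \<open>P\<close> by a 1 by 1 identity block. It fixes
    the first unit vector, so the first column of \<open>H * B\<close> is still
    \<open>v\<close>.\<close>
  define B where "B = four_block_mat (1\<^sub>m 1) (0\<^sub>m 1 n) (0\<^sub>m n 1) P"
  have B: "B \<in> carrier_mat (Suc n) (Suc n)" using P by (auto simp: B_def)
  have D: "mat_diag (Suc n) (\<lambda>i. (e # es) ! i) =
      four_block_mat (mat 1 1 (\<lambda>_. e)) (0\<^sub>m 1 n) (0\<^sub>m n 1) (mat_diag n (\<lambda>i. es ! i))"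
    by (rule eq_matI) (auto simp: mat_diag_def nth_Cons')
  have BB: "transpose_mat B * B = 1\<^sub>m (Suc n)"
    unfolding B_def using P
    by (subst transpose_four_block_mat[of _ 1 1 _ n _ n])
       (auto simp: mult_four_block_mat[of _ 1 1 _ n _ n _ _ 1 _ n])
  have KB: "K * B = B * mat_diag (Suc n) (\<lambda>i. (e # es) ! i)"
    unfolding N(3) B_def D using P N(1)
    by (auto simp: left_mult_zero_mat[OF mat_diag_dim] mult_four_block_mat[of _ 1 1 _ n _ n _ _ 1 _ n])
  show ?case unfolding n0
  proof (intro bexI[of _ "H * B"] conjI impI)
    have "transpose_mat (H * B) * (H * B) = transpose_mat B * (H * H) * B"
      using H(1,2) B by (simp add: transpose_mult[of _ "Suc n" "Suc n" _ "Suc n"] assoc_mult_mat[of _ "Suc n" "Suc n" _ "Suc n" _ "Suc n"])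
    thus "transpose_mat (H * B) * (H * B) = 1\<^sub>m (Suc n)" using H(3) B BB by simp
    have "M * (H * B) = (H * H) * (M * (H * B))"
      using H M B by simp
    also have "\<dots> = H * (K * B)"
      unfolding K_def using H(1) M B
      by (simp add: assoc_mult_mat[of _ "Suc n" "Suc n" _ "Suc n" _ "Suc n"])
    also have "\<dots> = H * B * mat_diag (Suc n) (\<lambda>i. (e # es) ! i)"
      unfolding KB using H(1) B by (simp add: assoc_mult_mat[of _ "Suc n" "Suc n" _ "Suc n" _ "Suc n"])
    finally show "M * (H * B) = H * B * mat_diag (Suc n) (\<lambda>i. (e # es) ! i)" .
    have "B *\<^sub>v ?e1 = ?e1"
      by (rule eq_vecI) (use B in \<open>auto simp: B_def scalar_prod_right_unit\<close>)
    thus "H * B *\<^sub>v ?e1 = v" using H B by (simp add: assoc_mult_mat_vec[OF H(1) B])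
  qed (use H B in auto)
qed

section \<open>The power method in eigencoordinates\<close>

text \<open>The columns of \<open>Q\<close> form an orthonormal eigenbasis. Indices start from 0, so
  \<open>l 0\<close> stands for lambda_1; order and positivity of the eigenvalues enter as
  hypotheses of individual lemmas.\<close>

locale orthonormal_eigenbasis =
  fixes d :: nat and M Q :: "real mat" and l :: "nat \<Rightarrow> real"
  assumes M: "M \<in> carrier_mat d d" and Q: "Q \<in> carrier_mat d d"
    and QtQ: "transpose_mat Q * Q = 1\<^sub>m d" and MQ: "M * Q = Q * mat_diag d l"
begin

section \<open>Coordinates in the eigenbasis\<close>

definition coord :: "nat \<Rightarrow> real vec \<Rightarrow> real" where
  "coord i x = col Q i \<bullet> x"

lemma coord_eq: "i < d \<Longrightarrow> x \<in> carrier_vec d \<Longrightarrow> coord i x = (transpose_mat Q *\<^sub>v x) $ i"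
  using Q by (simp add: coord_def mult_mat_vec_def)

lemma QQt: "Q * transpose_mat Q = 1\<^sub>m d"
  by (rule mat_mult_left_right_inverse[OF _ Q QtQ]) (use Q in simp)

lemma expansion: "x \<in> carrier_vec d \<Longrightarrow> Q *\<^sub>v (transpose_mat Q *\<^sub>v x) = x"
  using Q QQt by (simp add: assoc_mult_mat_vec[of Q d d "transpose_mat Q" d, symmetric])

text \<open>Parseval's identity: \<open>y\<close> is expanded in the basis and \<open>Q\<close>
  moves to the other factor by transposition.\<close>

lemma inner_coord:
  assumes "x \<in> carrier_vec d" "y \<in> carrier_vec d"
  shows "x \<bullet> y = (\<Sum>i<d. coord i x * coord i y)"
proof -
  have "x \<bullet> y = x \<bullet> (Q *\<^sub>v (transpose_mat Q *\<^sub>v y))" using assms by (simp add: expansion)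
  also have "\<dots> = (transpose_mat Q *\<^sub>v x) \<bullet> (transpose_mat Q *\<^sub>v y)"
    by (rule transpose_vec_mult_scalar[OF Q _ assms(1), symmetric]) (use Q assms in simp)
  also have "\<dots> = (\<Sum>i<d. coord i x * coord i y)"
    using Q assms by (auto simp: scalar_prod_def coord_eq atLeast0LessThan simp del: index_mult_mat_vec intro!: sum.cong)
  finally show ?thesis .
qed

lemma coord_smult: "i < d \<Longrightarrow> x \<in> carrier_vec d \<Longrightarrow> coord i (a \<cdot>\<^sub>v x) = a * coord i x"
  using Q by (simp add: coord_def)

text \<open>Multiplying \<open>M * Q = Q * mat_diag d l\<close> by the transpose of \<open>Q\<close>
  from both sides shows that passing to coordinates turns \<open>M\<close> into the diagonal
  matrix.\<close>

lemma coord_mult: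
  assumes i: "i < d" and x: "x \<in> carrier_vec d"
  shows "coord i (M *\<^sub>v x) = l i * coord i x"
proof -
  have tQ: "transpose_mat Q \<in> carrier_mat d d" using Q by simp
  have D: "mat_diag d l \<in> carrier_mat d d" by simp
  have "transpose_mat Q * M = transpose_mat Q * (M * Q) * transpose_mat Q"
    using Q M tQ QQt by (simp add: assoc_mult_mat[of _ d d _ d _ d])
  also have "\<dots> = (transpose_mat Q * Q) * mat_diag d l * transpose_mat Q"
    unfolding MQ by (simp add: assoc_mult_mat[OF tQ Q D])
  also have "\<dots> = mat_diag d l * transpose_mat Q"
    by (simp add: QtQ left_mult_one_mat[OF D])
  finally have e: "transpose_mat Q * M = mat_diag d l * transpose_mat Q" .
  have "transpose_mat Q *\<^sub>v (M *\<^sub>v x) = mat_diag d l *\<^sub>v (transpose_mat Q *\<^sub>v x)"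
    using e by (simp add: assoc_mult_mat_vec[OF tQ M x, symmetric] assoc_mult_mat_vec[OF D tQ x])
  hence "coord i (M *\<^sub>v x) = (mat_diag d l *\<^sub>v (transpose_mat Q *\<^sub>v x)) $ i"
    using i x M by (simp add: coord_eq del: index_mult_mat_vec)
  also have "\<dots> = (\<Sum>j\<in>{0..<d}. (if i = j then l j else 0) * (transpose_mat Q *\<^sub>v x) $ j)"
    using i Q x by (auto simp: mat_diag_def scalar_prod_def intro!: sum.cong)
  also have "\<dots> = (\<Sum>j\<in>{0..<d}. if j = i then l i * (transpose_mat Q *\<^sub>v x) $ i else 0)"
    by (intro sum.cong) auto
  also have "\<dots> = l i * coord i x" using i x by (simp add: coord_eq)
  finally show ?thesis .
qed

lemma unit_sphere_coord:
  assumes "x \<in> unit_sphere d" shows "(\<Sum>i<d. (coord i x)\<^sup>2) = 1"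
  using assms inner_coord[of x x] by (simp add: unit_sphere_def norm2_def power2_eq_square)

lemma coord_le_1:
  assumes "x \<in> unit_sphere d" "i < d" shows "\<bar>coord i x\<bar> \<le> 1"
proof -
  have "(coord i x)\<^sup>2 \<le> (\<Sum>i<d. (coord i x)\<^sup>2)"
    by (rule member_le_sum) (use assms in auto)
  thus ?thesis using unit_sphere_coord[OF assms(1)] by (simp add: abs_square_le_1)
qed

text \<open>Translates the hypothesis on the angle into a nonvanishing coordinate. The bound
  \<open>coord_le_1\<close> keeps the argument of \<open>arccos\<close> in its domain; the absolute
  value appears because the angle is one between lines.\<close>

lemma cos_angle:
  assumes "x \<in> unit_sphere d" "i < d"
  shows "cos (angle x (col Q i)) = \<bar>coord i x\<bar>"
proof -
  have "(transpose_mat Q * Q) $$ (i,i) = 1" using QtQ assms by simp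
  hence "norm2 (col Q i) = 1" using Q assms by (simp add: norm2_def)
  moreover have "x \<bullet> col Q i = coord i x"
    unfolding coord_def by (rule comm_scalar_prod[of _ d]) (use assms Q in \<open>auto simp: unit_sphere_def\<close>)
  ultimately show ?thesis using assms coord_le_1[OF assms]
    by (simp add: angle_def unit_sphere_def cos_arccos_abs)
qed

section \<open>Normalization and the power iterates\<close>

lemma normalize_vec_in_unit_sphere:
  assumes "x \<in> carrier_vec d" "x \<bullet> x > 0"
  shows "normalize_vec x \<in> unit_sphere d" 
proof -
  have "((1 / norm2 x) \<cdot>\<^sub>v x) \<bullet> ((1 / norm2 x) \<cdot>\<^sub>v x) = (x \<bullet> x) / (norm2 x)\<^sup>2"
    using assms by (simp add: power2_eq_square)
  thus ?thesis using assms by (simp add: unit_sphere_def normalize_vec_def norm2_def)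
qed

lemma inner_self_pos:
  assumes "x \<in> carrier_vec d" "i < d" "coord i x \<noteq> 0"
  shows "x \<bullet> x > 0"
  unfolding inner_coord[OF assms(1,1)]
  by (rule sum_pos2[where i = i]) (use assms in \<open>auto simp: zero_less_mult_iff\<close>)

lemma coord_normalize_vec_nonzero:
  assumes "x \<in> carrier_vec d" "i < d" "coord i x \<noteq> 0"
  shows "coord i (normalize_vec x) \<noteq> 0"
  using assms inner_self_pos[OF assms] by (simp add: normalize_vec_def norm2_def coord_smult)

text \<open>\<open>M\<close> scales each coordinate by its eigenvalue and every normalization scales
  all of them by a common positive factor; \<open>\<kappa>\<close> collects these factors.\<close>

lemma power_iterate_coord:
  assumes x: "x \<in> unit_sphere d" and pos: "\<And>i. i < d \<Longrightarrow> 0 < l i"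
  shows "power_iterate M x q \<in> unit_sphere d \<and>
    (\<exists>\<kappa>>0. \<forall>i<d. coord i (power_iterate M x q) = \<kappa> * l i ^ q * coord i x)"
proof (induction q)
  case 0
  show ?case using x by (auto intro!: exI[of _ 1])
next
  case (Suc q)
  define y where "y = power_iterate M x q"
  obtain \<kappa> where y: "y \<in> unit_sphere d" and \<kappa>: "\<kappa> > 0"
    and c: "\<And>i. i < d \<Longrightarrow> coord i y = \<kappa> * l i ^ q * coord i x"
    using Suc unfolding y_def by blast
  have yc: "y \<in> carrier_vec d" using y by (simp add: unit_sphere_def)
  hence My: "M *\<^sub>v y \<in> carrier_vec d" using M by simp
  \<comment> \<open>A unit vector has a nonzero coordinate, and a positive eigenvalue keeps it
    nonzero, so the normalization does not divide by zero.\<close>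
  obtain i where "i < d" "coord i y \<noteq> 0"
    using unit_sphere_coord[OF y] by (metis (no_types, lifting) lessThan_iff power_zero_numeral sum.neutral zero_neq_one)
  hence "coord i (M *\<^sub>v y) \<noteq> 0" using pos[of i] coord_mult[OF _ yc] by simp
  hence p: "(M *\<^sub>v y) \<bullet> (M *\<^sub>v y) > 0" by (rule inner_self_pos[OF My \<open>i < d\<close>])
  have "power_iterate M x (Suc q) \<in> unit_sphere d"
    using normalize_vec_in_unit_sphere[OF My p] by (simp add: y_def)
  moreover have "coord i (power_iterate M x (Suc q)) = (\<kappa> / norm2 (M *\<^sub>v y)) * l i ^ Suc q * coord i x"
    if "i < d" for i
    using that My yc c[OF that]
    by (simp add: y_def[symmetric] normalize_vec_def coord_smult coord_mult)
  moreover have "\<kappa> / norm2 (M *\<^sub>v y) > 0" using \<kappa> p by (simp add: norm2_def)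
  ultimately show ?case by blast
qed

text \<open>The squared coordinates of a unit vector are weights of sum 1, and the Rayleigh quotient
  is the weighted mean of the eigenvalues. If \<open>a\<close> bounds the spectrum from above, all
  summands are nonnegative.\<close>

lemma rayleigh_quotient_deficit:
  assumes "x \<in> unit_sphere d"
  shows "a - x \<bullet> (M *\<^sub>v x) = (\<Sum>i<d. (a - l i) * (coord i x)\<^sup>2)"
proof -
  have xc: "x \<in> carrier_vec d" using assms by (simp add: unit_sphere_def)
  hence "x \<bullet> (M *\<^sub>v x) = (\<Sum>i<d. coord i x * coord i (M *\<^sub>v x))"
    using M by (intro inner_coord) auto
  also have "\<dots> = (\<Sum>i<d. l i * (coord i x)\<^sup>2)"
    by (intro sum.cong) (auto simp: coord_mult[OF _ xc] power2_eq_square)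
  finally have "a - x \<bullet> (M *\<^sub>v x) = a * (\<Sum>i<d. (coord i x)\<^sup>2) - (\<Sum>i<d. l i * (coord i x)\<^sup>2)"
    using unit_sphere_coord[OF assms] by simp
  thus ?thesis by (simp add: sum_distrib_left left_diff_distrib sum_subtractf)
qed

section \<open>Rayleigh quotients of the iterates: bounds, limit and rate\<close>

lemma power_rayleigh_le:
  assumes x: "x \<in> unit_sphere d" and pos: "\<And>i. i < d \<Longrightarrow> 0 < l i"
    and top: "\<And>i. i < d \<Longrightarrow> l i \<le> a"
  shows "power_iterate M x q \<bullet> (M *\<^sub>v power_iterate M x q) \<le> a"
proof -
  have "0 \<le> a - power_iterate M x q \<bullet> (M *\<^sub>v power_iterate M x q)"
    using power_iterate_coord[OF x pos, of q] top
    by (subst rayleigh_quotient_deficit) (auto intro!: sum_nonneg)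
  thus ?thesis by simp
qed

text \<open>Coordinate \<open>k\<close> stays nonzero in every iterate, so its summand in the
  deficit is strictly positive.\<close>

lemma power_rayleigh_less:
  assumes x: "x \<in> unit_sphere d" and pos: "\<And>i. i < d \<Longrightarrow> 0 < l i"
    and top: "\<And>i. i < d \<Longrightarrow> l i \<le> a"
    and k: "k < d" "l k < a" "coord k x \<noteq> 0"
  shows "power_iterate M x q \<bullet> (M *\<^sub>v power_iterate M x q) < a"
proof -
  have y: "power_iterate M x q \<in> unit_sphere d" and ck: "coord k (power_iterate M x q) \<noteq> 0"
    using power_iterate_coord[OF x pos, of q] k pos[of k] by auto
  have "0 < a - power_iterate M x q \<bullet> (M *\<^sub>v power_iterate M x q)"
    unfolding rayleigh_quotient_deficit[OF y]
    by (rule sum_pos2[where i = k]) (use k ck top in auto)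
  thus ?thesis by simp
qed

text \<open>The ratios are kept apart so that the bound serves twice: term by term for convergence,
  and with one common ratio for the rate.\<close>

lemma power_rayleigh_error:
  assumes x: "x \<in> unit_sphere d" and pos: "\<And>i. i < d \<Longrightarrow> 0 < l i"
    and top: "\<And>i. i < d \<Longrightarrow> l i \<le> l 0" and d: "0 < d" and c0: "coord 0 x \<noteq> 0"
  shows "l 0 - power_iterate M x q \<bullet> (M *\<^sub>v power_iterate M x q)
    \<le> (\<Sum>i<d. (l 0 - l i) * (coord i x / coord 0 x)\<^sup>2 * (l i / l 0) ^ (2 * q))"
proof -
  obtain \<kappa> where y: "power_iterate M x q \<in> unit_sphere d" and \<kappa>: "\<kappa> > 0"
    and c: "\<And>i. i < d \<Longrightarrow> coord i (power_iterate M x q) = \<kappa> * l i ^ q * coord i x"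
    using power_iterate_coord[OF x pos, of q] by blast
  have l0: "l 0 > 0" using pos d by simp
  have "\<bar>\<kappa> * l 0 ^ q * coord 0 x\<bar> \<le> 1" using coord_le_1[OF y d] c[OF d] by simp
  hence "\<kappa> \<le> 1 / (l 0 ^ q * \<bar>coord 0 x\<bar>)"
    using \<kappa> l0 c0 by (simp add: abs_mult field_simps)
  hence "\<kappa>\<^sup>2 \<le> (1 / (l 0 ^ q * \<bar>coord 0 x\<bar>))\<^sup>2" using \<kappa> by (intro power_mono) auto
  hence \<kappa>2: "\<kappa>\<^sup>2 \<le> 1 / (l 0 ^ (2 * q) * (coord 0 x)\<^sup>2)"
    by (simp add: power_divide power_mult_distrib power_mult[symmetric] mult.commute)
  show ?thesis unfolding rayleigh_quotient_deficit[OF y]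
  proof (rule sum_mono)
    fix i assume i: "i \<in> {..<d}"
    have "(coord i (power_iterate M x q))\<^sup>2 = \<kappa>\<^sup>2 * (l i ^ (2 * q) * (coord i x)\<^sup>2)"
      using c i by (simp add: power_mult_distrib power_mult[symmetric] mult.commute)
    also have "\<dots> \<le> 1 / (l 0 ^ (2 * q) * (coord 0 x)\<^sup>2) * (l i ^ (2 * q) * (coord i x)\<^sup>2)"
      using \<kappa>2 by (rule mult_right_mono) (use pos[of i] i in auto)
    also have "\<dots> = (coord i x / coord 0 x)\<^sup>2 * (l i / l 0) ^ (2 * q)"
      by (simp add: power_divide mult.commute)
    finally show "(l 0 - l i) * (coord i (power_iterate M x q))\<^sup>2
        \<le> (l 0 - l i) * (coord i x / coord 0 x)\<^sup>2 * (l i / l 0) ^ (2 * q)"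
      unfolding mult.assoc by (rule mult_left_mono) (use top i in auto)
  qed
qed

lemma power_rayleigh_tendsto:
  assumes x: "x \<in> unit_sphere d" and pos: "\<And>i. i < d \<Longrightarrow> 0 < l i"
    and top: "\<And>i. i < d \<Longrightarrow> l i \<le> l 0" and d: "0 < d" and c0: "coord 0 x \<noteq> 0"
  shows "(\<lambda>q. power_iterate M x q \<bullet> (M *\<^sub>v power_iterate M x q)) \<longlonglongrightarrow> l 0"
proof -
  have "(\<lambda>q. \<Sum>i<d. (l 0 - l i) * (coord i x / coord 0 x)\<^sup>2 * (l i / l 0) ^ (2 * q)) \<longlonglongrightarrow> (\<Sum>i<d. 0)"
  proof (rule tendsto_sum)
    fix i assume i: "i \<in> {..<d}"
    show "(\<lambda>q. (l 0 - l i) * (coord i x / coord 0 x)\<^sup>2 * (l i / l 0) ^ (2 * q)) \<longlonglongrightarrow> 0"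
    \<comment> \<open>A multiple largest eigenvalue does no harm: the factor
      \<open>l 0 - l i\<close> removes its terms, and all other ratios are below 1.\<close>
    proof (cases "l i = l 0")
      case False
      hence "l i / l 0 < 1" "0 < l i / l 0" using i top[of i] pos[of i] pos[OF d] by auto
      hence "(\<lambda>q. ((l i / l 0)\<^sup>2) ^ q) \<longlonglongrightarrow> 0"
        by (intro LIMSEQ_realpow_zero) (auto simp: abs_square_less_1)
      thus ?thesis unfolding power_mult by (rule tendsto_mult_right_zero)
    qed simp
  qed
  hence lim: "(\<lambda>q. l 0 - (\<Sum>i<d. (l 0 - l i) * (coord i x / coord 0 x)\<^sup>2 * (l i / l 0) ^ (2 * q))) \<longlonglongrightarrow> l 0"
    using tendsto_diff[OF tendsto_const, of _ 0 sequentially "l 0"] by simp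
  show ?thesis
  proof (rule tendsto_sandwich[OF _ _ lim tendsto_const])
    show "\<forall>\<^sub>F q in sequentially. l 0 - (\<Sum>i<d. (l 0 - l i) * (coord i x / coord 0 x)\<^sup>2 * (l i / l 0) ^ (2 * q))
        \<le> power_iterate M x q \<bullet> (M *\<^sub>v power_iterate M x q)"
      using power_rayleigh_error[OF x pos top d c0] by (intro always_eventually allI) (simp add: algebra_simps)
    show "\<forall>\<^sub>F q in sequentially. power_iterate M x q \<bullet> (M *\<^sub>v power_iterate M x q) \<le> l 0"
      using power_rayleigh_le[OF x pos top] by simp
  qed
qed

text \<open>With lambda_2 for \<open>b\<close>, the ratio \<open>b / l 0\<close> is one minus the
  spectral gap; the exponent \<open>2 * q\<close> arises because the deficit is quadratic in the
  coordinates. If \<open>b = l 0\<close>, the bound does not decay and convergence rests on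
  \<open>power_rayleigh_tendsto\<close>.\<close>

lemma power_rayleigh_rate:
  assumes x: "x \<in> unit_sphere d" and pos: "\<And>i. i < d \<Longrightarrow> 0 < l i"
    and top: "\<And>i. i < d \<Longrightarrow> l i \<le> l 0" and d: "0 < d" and c0: "coord 0 x \<noteq> 0"
    and second: "\<And>i. 0 < i \<Longrightarrow> i < d \<Longrightarrow> l i \<le> b"
  shows "\<bar>power_iterate M x q \<bullet> (M *\<^sub>v power_iterate M x q) - l 0\<bar>
    \<le> (\<Sum>i<d. (l 0 - l i) * (coord i x / coord 0 x)\<^sup>2) * (b / l 0) ^ (2 * q)"
proof -
  have "\<bar>power_iterate M x q \<bullet> (M *\<^sub>v power_iterate M x q) - l 0\<bar>
      \<le> (\<Sum>i<d. (l 0 - l i) * (coord i x / coord 0 x)\<^sup>2 * (l i / l 0) ^ (2 * q))"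
    using power_rayleigh_le[OF x pos top, of q] power_rayleigh_error[OF x pos top d c0, of q]
    by (smt (verit))
  also have "\<dots> \<le> (\<Sum>i<d. (l 0 - l i) * (coord i x / coord 0 x)\<^sup>2 * (b / l 0) ^ (2 * q))"
  proof (rule sum_mono)
    fix i assume i: "i \<in> {..<d}"
    show "(l 0 - l i) * (coord i x / coord 0 x)\<^sup>2 * (l i / l 0) ^ (2 * q)
        \<le> (l 0 - l i) * (coord i x / coord 0 x)\<^sup>2 * (b / l 0) ^ (2 * q)"
    \<comment> \<open>\<open>second\<close> says nothing about index 0, but there the factor
      \<open>l 0 - l i\<close> is zero.\<close>
    proof (cases "i = 0")
      case False
      hence "(l i / l 0) ^ (2 * q) \<le> (b / l 0) ^ (2 * q)"
        using i second[of i] pos[of i] pos[OF d] by (intro power_mono divide_right_mono) auto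
      thus ?thesis using i top[of i] by (intro mult_left_mono) auto
    qed simp
  qed
  finally show ?thesis by (simp add: sum_distrib_right)
qed

end

section \<open>Null hyperplanes\<close>

text \<open>The next two bounds need no measurability: both constructions fall back to the zero measure
  when the set function at hand is not a measure.\<close>

lemma emeasure_distr_le: "emeasure (distr M N f) A \<le> emeasure M (f -` A \<inter> space M)"
  unfolding distr_def emeasure_measure_of_conv by auto

lemma emeasure_restrict_space_le: "emeasure (restrict_space M S) A \<le> emeasure M A"
  unfolding restrict_space_def emeasure_measure_of_conv by auto

text \<open>The sigma-algebra of \<open>borel_vec\<close> is pulled back from functions, so it
  suffices that the composition back to functions, a mere restriction, is measurable.\<close>

lemma vec_measurable_borel_vec:
  assumes "\<And>i. sets (M i) = sets borel"
  shows "Matrix.vec d \<in> measurable (\<Pi>\<^sub>M i\<in>{..<d}. M i) (borel_vec d)"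
  unfolding borel_vec_def
proof (rule measurable_vimage_algebra2)
  have "(\<lambda>f. \<lambda>i\<in>{..<d}. f i) \<in> measurable (\<Pi>\<^sub>M i\<in>{..<d}. M i) (\<Pi>\<^sub>M i\<in>{..<d}. borel)"
  proof (rule measurable_restrict)
    fix i assume "i \<in> {..<d}"
    thus "(\<lambda>f. f i) \<in> measurable (\<Pi>\<^sub>M i\<in>{..<d}. M i) borel"
      using measurable_component_singleton[of i "{..<d}" M] assms[of i]
        measurable_cong_sets[OF refl assms[of i]] by blast
  qed
  also have "?this \<longleftrightarrow> (\<lambda>f. \<lambda>i\<in>{..<d}. Matrix.vec d f $ i) \<in> measurable (\<Pi>\<^sub>M i\<in>{..<d}. M i) (\<Pi>\<^sub>M i\<in>{..<d}. borel)"
    by (intro arg_cong2[where f = "(\<in>)"] ext refl) (auto simp: restrict_def)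
  finally show "\<dots>" .
qed auto

lemma hyperplane_in_borel_vec:
  assumes u: "u \<in> carrier_vec d"
  shows "{v \<in> carrier_vec d. u \<bullet> v = 0} \<in> sets (borel_vec d)"
proof -
  let ?g = "\<lambda>v::real vec. \<lambda>i\<in>{..<d}. v $ i"
  have "{f \<in> space (\<Pi>\<^sub>M i\<in>{..<d}. (borel :: real measure)). (\<Sum>i<d. u $ i * f i) = 0} \<in> sets (\<Pi>\<^sub>M i\<in>{..<d}. borel)"
    by measurable
  from in_vimage_algebra[OF this, of ?g "carrier_vec d"]
  have "?g -` {f \<in> space (\<Pi>\<^sub>M i\<in>{..<d}. (borel :: real measure)). (\<Sum>i<d. u $ i * f i) = 0} \<inter> carrier_vec d
      \<in> sets (borel_vec d)" by (simp add: borel_vec_def)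
  also have "?g -` {f \<in> space (\<Pi>\<^sub>M i\<in>{..<d}. (borel :: real measure)). (\<Sum>i<d. u $ i * f i) = 0} \<inter> carrier_vec d
      = {v \<in> carrier_vec d. u \<bullet> v = 0}"
    using u by (auto simp: scalar_prod_def atLeast0LessThan space_PiM)
  finally show ?thesis .
qed

text \<open>Fubini with coordinate \<open>k\<close> split off: once the other coordinates are fixed,
  the equation leaves at most one value for coordinate \<open>k\<close>, and single points have
  measure zero.\<close>

lemma emeasure_PiM_hyperplane:
  fixes M :: "'i \<Rightarrow> real measure"
  assumes "product_sigma_finite M"
    and sets: "\<And>i. sets (M i) = sets borel" and atomless: "\<And>i x. emeasure (M i) {x} = 0"
    and I: "finite I" "k \<in> I" and u: "u k \<noteq> 0"
  shows "emeasure (Pi\<^sub>M I M) {f \<in> space (Pi\<^sub>M I M). (\<Sum>i\<in>I. u i * f i) = 0} = 0"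
proof -
  interpret product_sigma_finite M by fact
  define J where "J = I - {k}"
  have J: "finite J" "k \<notin> J" "I = insert k J" using I by (auto simp: J_def)
  let ?H = "{f \<in> space (Pi\<^sub>M I M). (\<Sum>i\<in>I. u i * f i) = 0}"
  have comp: "(\<lambda>f. f i) \<in> borel_measurable (Pi\<^sub>M I M)" if "i \<in> I" for i
    using measurable_component_singleton[OF that, of M] measurable_cong_sets[OF refl sets[of i]] by blast
  have H: "?H \<in> sets (Pi\<^sub>M I M)"
  proof -
    have "(\<lambda>f. \<Sum>i\<in>I. u i * f i) \<in> borel_measurable (Pi\<^sub>M I M)"
      using comp by (intro borel_measurable_sum borel_measurable_times) auto
    from measurable_sets[OF this, of "{0}"] show ?thesis
      by (simp add: vimage_def Int_def conj_commute)
  qed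
  have "emeasure (Pi\<^sub>M I M) ?H = (\<integral>\<^sup>+ f. indicator ?H f \<partial>Pi\<^sub>M I M)" using H by simp
  also have "\<dots> = (\<integral>\<^sup>+ f. (\<integral>\<^sup>+ y. indicator ?H (f(k := y)) \<partial>M k) \<partial>Pi\<^sub>M J M)"
    unfolding J(3) by (rule product_nn_integral_insert[OF J(1,2)]) (use H in \<open>simp add: J(3)\<close>)
  also have "\<dots> = (\<integral>\<^sup>+ f. 0 \<partial>Pi\<^sub>M J M)"
  proof (rule nn_integral_cong)
    fix f
    \<comment> \<open>The solution of the linear equation for coordinate \<open>k\<close>; dividing
      is possible because \<open>u k\<close> is nonzero.\<close>
    define t where "t = - (\<Sum>i\<in>J. u i * f i) / u k"
    have "(\<integral>\<^sup>+ y. indicator ?H (f(k := y)) \<partial>M k) \<le> (\<integral>\<^sup>+ y. indicator {t} y \<partial>M k)"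
    proof (rule nn_integral_mono)
      fix y
      have "y = t" if "f(k := y) \<in> ?H"
      proof -
        have "u k * y + (\<Sum>i\<in>J. u i * (f(k := y)) i) = 0" using that J by simp
        also have "(\<Sum>i\<in>J. u i * (f(k := y)) i) = (\<Sum>i\<in>J. u i * f i)"
          using J by (intro sum.cong) auto
        finally show ?thesis using u by (simp add: t_def field_simps)
      qed
      thus "indicator ?H (f(k := y)) \<le> (indicator {t} y :: ennreal)"
        by (auto simp: indicator_def)
    qed
    also have "\<dots> = 0" using sets atomless by (subst nn_integral_indicator) auto
    finally show "(\<integral>\<^sup>+ y. indicator ?H (f(k := y)) \<partial>M k) = 0" by simp
  qed
  finally show ?thesis by simp
qed

text \<open>Stated for arbitrary atomless factors, so that Lebesgue and Gaussian measure are both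
  instances.\<close>

lemma hyperplane_null_distr_vec:
  assumes "product_sigma_finite M" and sets: "\<And>i. sets (M i) = sets borel"
    and atomless: "\<And>i x. emeasure (M i) {x} = 0"
    and u: "u \<in> carrier_vec d" "u \<noteq> 0\<^sub>v d"
  shows "{v \<in> carrier_vec d. u \<bullet> v = 0} \<in> null_sets (distr (\<Pi>\<^sub>M i\<in>{..<d}. M i) (borel_vec d) (Matrix.vec d))"
proof -
  obtain k where k: "k \<in> {..<d}" "u $ k \<noteq> 0" using u by (auto simp: vec_eq_iff)
  have "Matrix.vec d -` {v \<in> carrier_vec d. u \<bullet> v = 0} \<inter> space (\<Pi>\<^sub>M i\<in>{..<d}. M i)
      = {f \<in> space (\<Pi>\<^sub>M i\<in>{..<d}. M i). (\<Sum>i<d. u $ i * f i) = 0}"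
    by (auto simp: scalar_prod_def atLeast0LessThan)
  moreover have "emeasure (\<Pi>\<^sub>M i\<in>{..<d}. M i) {f \<in> space (\<Pi>\<^sub>M i\<in>{..<d}. M i). (\<Sum>i<d. u $ i * f i) = 0} = 0"
    using emeasure_PiM_hyperplane[OF assms(1) sets atomless, of "{..<d}" k "\<lambda>i. u $ i"] k by simp
  ultimately show ?thesis
    using emeasure_distr[OF vec_measurable_borel_vec[of M, OF sets] hyperplane_in_borel_vec[OF u(1)]]
      hyperplane_in_borel_vec[OF u(1)]
    by (intro null_setsI) auto
qed

lemma hyperplane_null_lborel_vec:
  assumes "u \<in> carrier_vec d" "u \<noteq> 0\<^sub>v d"
  shows "{v \<in> carrier_vec d. u \<bullet> v = 0} \<in> null_sets (lborel_vec d)"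
  unfolding lborel_vec_def
  by (rule hyperplane_null_distr_vec[OF _ _ _ assms])
     (auto simp: product_sigma_finite_def intro: lborel.sigma_finite_measure_axioms)

text \<open>The normal distribution is a probability measure, hence sigma-finite, and has a Lebesgue
  density, hence no atoms.\<close>

lemma hyperplane_null_std_gaussian_vec:
  assumes "u \<in> carrier_vec d" "u \<noteq> 0\<^sub>v d"
  shows "{v \<in> carrier_vec d. u \<bullet> v = 0} \<in> null_sets (std_gaussian_vec d)"
  unfolding std_gaussian_vec_def
proof (rule hyperplane_null_distr_vec[OF _ _ _ assms])
  show "product_sigma_finite (\<lambda>_. density lborel (\<lambda>t. ennreal (std_normal_density t)))"
    using prob_space_normal_density[of 1 0] unfolding product_sigma_finite_def
    by (simp add: prob_space_imp_sigma_finite)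
  show "emeasure (density lborel (\<lambda>t. ennreal (std_normal_density t))) {x} = 0" for x
    by (subst emeasure_density) (auto simp: nn_integral_null_set null_sets_def)
qed simp

lemma AE_std_gaussian_vec_not_orthogonal:
  assumes "u \<in> carrier_vec d" "u \<noteq> 0\<^sub>v d"
  shows "AE g in std_gaussian_vec d. g \<in> carrier_vec d \<and> u \<bullet> g \<noteq> 0"
  by (rule AE_I'[OF hyperplane_null_std_gaussian_vec[OF assms]])
     (auto simp: std_gaussian_vec_def borel_vec_def)

section \<open>Samuelson's inequality\<close>

text \<open>The variance identity: the gap in the Cauchy-Schwarz inequality against a constant
  vector, written as a sum of squares. It makes the equality case visible.\<close>

lemma card_sum_squares_minus_square_sum:
  fixes t :: "'a \<Rightarrow> real"
  assumes "finite I"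
  shows "real (card I) * (\<Sum>i\<in>I. (t i)\<^sup>2) - (\<Sum>i\<in>I. t i)\<^sup>2
    = real (card I) * (\<Sum>i\<in>I. (t i - (\<Sum>j\<in>I. t j) / card I)\<^sup>2)"
proof (cases "I = {}")
  case False
  define k where "k = real (card I)"
  define m where "m = (\<Sum>i\<in>I. t i) / k"
  have k: "k \<noteq> 0" using False assms by (simp add: k_def)
  hence S: "(\<Sum>i\<in>I. t i) = k * m" by (simp add: m_def)
  have "(\<Sum>i\<in>I. (t i - m)\<^sup>2) = (\<Sum>i\<in>I. (t i)\<^sup>2 - 2 * m * t i + m\<^sup>2)"
    by (intro sum.cong) (auto simp: power2_diff)
  also have "\<dots> = (\<Sum>i\<in>I. (t i)\<^sup>2) - 2 * m * (k * m) + k * m\<^sup>2"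
    by (simp add: sum.distrib sum_subtractf sum_distrib_left[symmetric] S k_def)
  finally have e: "(\<Sum>i\<in>I. (t i - m)\<^sup>2) = (\<Sum>i\<in>I. (t i)\<^sup>2) - k * m\<^sup>2"
    by (simp add: power2_eq_square)
  show ?thesis
    unfolding k_def[symmetric] unfolding m_def[symmetric] e unfolding S
    by (simp add: right_diff_distrib power2_eq_square)
qed simp

text \<open>\<open>S\<close> sums the distances to lambda_1, so \<open>S / real d\<close> is
  lambda_1 minus the mean. \<open>G\<close> is the squared spread of these distances about their own
  mean. Both Samuelson's inequality and its equality case can be read off this formula.\<close>

lemma lam_TDep_deviation:
  fixes lam :: "nat \<Rightarrow> real"
  assumes d: "1 \<le> d"
  defines "S \<equiv> \<Sum>i=2..d. lam 1 - lam i"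
  defines "G \<equiv> \<Sum>i=2..d. (lam 1 - lam i - S / real (d - 1))\<^sup>2"
  shows "lam_TDep d lam - lam 1 = sqrt ((S / real d)\<^sup>2 + real (d - 1) * G / real d) - S / real d"
proof -
  let ?a = "lam 1"
  define R where "R = (\<Sum>i=2..d. (?a - lam i)\<^sup>2)"
  have split: "(\<Sum>i=1..d. f i) = f 1 + (\<Sum>i=2..d. f i)" for f :: "nat \<Rightarrow> real"
    using d by (simp add: sum.atLeast_Suc_atMost numeral_2_eq_2)
  have dpos: "real d > 0" and d1: "real (d - 1) = real d - 1" using d by (auto simp: of_nat_diff)
  have c: "real (card {2..d}) = real d - 1" using d by (simp add: of_nat_diff)
  have S: "(\<Sum>i=1..d. lam i) = real d * ?a - S"
    unfolding split S_def sum_subtractf using c by (simp add: algebra_simps)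
  have "(\<Sum>i=1..d. (lam i)\<^sup>2) = ?a\<^sup>2 + (\<Sum>i=2..d. (?a - lam i)\<^sup>2 - 2 * ?a * (?a - lam i) + ?a\<^sup>2)"
    unfolding split add_left_cancel by (rule sum.cong) (auto simp: power2_eq_square algebra_simps)
  hence R: "(\<Sum>i=1..d. (lam i)\<^sup>2) = real d * ?a\<^sup>2 - 2 * ?a * S + R"
    unfolding sum.distrib sum_subtractf[of "\<lambda>i. (?a - lam i)\<^sup>2"] sum_distrib_left[symmetric] S_def[symmetric] R_def[symmetric]
    using c by (simp add: algebra_simps)
  \<comment> \<open>The variance identity for the distances over \<open>{2..d}\<close> trades their
    second moment \<open>R\<close> for the spread \<open>G\<close>.\<close>
  have G: "(real d - 1) * R - S\<^sup>2 = (real d - 1) * G"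
    using card_sum_squares_minus_square_sum[of "{2..d}" "\<lambda>i. ?a - lam i"] c
    by (simp add: R_def S_def G_def d1)
  have m: "spec_mean d lam = ?a - S / d"
    using dpos unfolding spec_mean_def S by (simp add: right_diff_distrib)
  have "(1 / real d) * (\<Sum>i = 1..d. (lam i)\<^sup>2) = ?a\<^sup>2 - 2 * ?a * (S / d) + R / d"
    using dpos unfolding R by (simp add: right_diff_distrib distrib_left)
  hence v: "(1 / real d) * (\<Sum>i = 1..d. (lam i)\<^sup>2) - (spec_mean d lam)\<^sup>2 = R / d - (S / d)\<^sup>2"
    unfolding m by (simp add: power2_diff)
  have "(R / d - (S / d)\<^sup>2) * (real d - 1) = (S / d)\<^sup>2 + ((real d - 1) * R - S\<^sup>2) / d"
    using dpos by (simp add: divide_simps power2_eq_square) (simp add: algebra_simps)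
  hence W: "(R / d - (S / d)\<^sup>2) * (real d - 1) = (S / d)\<^sup>2 + (real d - 1) * G / d"
    unfolding G .
  have "spec_sd d lam * sqrt (real d - 1) = sqrt ((S / d)\<^sup>2 + (real d - 1) * G / d)"
    by (simp only: spec_sd_def v W real_sqrt_mult[symmetric])
  thus ?thesis unfolding lam_TDep_def m d1 by simp
qed

text \<open>The square root of \<open>(S / real d)\<^sup>2\<close> plus a nonnegative term is at
  least \<open>S / real d\<close>. Equality means that the extra term vanishes; the converse uses
  that \<open>S\<close> is nonnegative, by maximality of \<open>lam 1\<close>.\<close>

lemma
  fixes lam :: "nat \<Rightarrow> real"
  assumes d: "1 \<le> d" and top: "\<And>i. i \<in> {1..d} \<Longrightarrow> lam i \<le> lam 1"
  shows lam_TDep_ge: "lam 1 \<le> lam_TDep d lam"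
    and lam_TDep_eq_iff: "lam_TDep d lam = lam 1 \<longleftrightarrow> (\<forall>i \<in> {2..d}. lam i = lam 2)"
proof -
  define S where "S = (\<Sum>i=2..d. lam 1 - lam i)"
  define G where "G = (\<Sum>i=2..d. (lam 1 - lam i - S / real (d - 1))\<^sup>2)"
  define W where "W = (S / real d)\<^sup>2 + real (d - 1) * G / real d"
  have dev: "lam_TDep d lam - lam 1 = sqrt W - S / real d"
    using lam_TDep_deviation[OF d, of lam] by (simp add: S_def G_def W_def)
  have S0: "S / real d \<ge> 0" using top by (auto simp: S_def intro!: sum_nonneg divide_nonneg_nonneg)
  have G0: "G \<ge> 0" by (simp add: G_def sum_nonneg)
  have W0: "W \<ge> 0" using G0 by (simp add: W_def)
  have "S / real d \<le> sqrt W" by (rule real_le_rsqrt) (use G0 in \<open>simp add: W_def\<close>)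
  thus "lam 1 \<le> lam_TDep d lam" using dev by simp
  have e1: "lam_TDep d lam = lam 1 \<longleftrightarrow> sqrt W = S / real d" using dev by linarith
  have e2: "sqrt W = S / real d \<longleftrightarrow> W = (S / real d)\<^sup>2"
  proof
    assume "sqrt W = S / real d"
    thus "W = (S / real d)\<^sup>2" using real_sqrt_pow2[OF W0] by simp
  next
    assume "W = (S / real d)\<^sup>2"
    thus "sqrt W = S / real d" using S0 by (intro real_sqrt_unique) auto
  qed
  have e3: "W = (S / real d)\<^sup>2 \<longleftrightarrow> d = 1 \<or> G = 0" using d by (auto simp: W_def)
  \<comment> \<open>For \<open>d = 1\<close> the range \<open>{2..d}\<close> is empty and both sides
    hold; otherwise index 2 lies in the range and represents the common value.\<close>
  have e4: "d = 1 \<or> G = 0 \<longleftrightarrow> (\<forall>i \<in> {2..d}. lam i = lam 2)"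
  proof (cases "d = 1")
    case False
    hence d2: "2 \<in> {2..d}" and dp: "real (d - 1) > 0" using d by auto
    have G: "G = 0 \<longleftrightarrow> (\<forall>i\<in>{2..d}. lam 1 - lam i - S / real (d - 1) = 0)"
      by (simp add: G_def sum_nonneg_eq_0_iff)
    have "G = 0 \<longleftrightarrow> (\<forall>i \<in> {2..d}. lam i = lam 2)"
    proof
      assume "G = 0"
      hence eq: "lam i = lam 1 - S / real (d - 1)" if "i \<in> {2..d}" for i using G that by force
      show "\<forall>i \<in> {2..d}. lam i = lam 2" using eq eq[OF d2] by metis
    next
      assume eq: "\<forall>i \<in> {2..d}. lam i = lam 2"
      have "S = (\<Sum>i=2..d. lam 1 - lam 2)" unfolding S_def by (rule sum.cong) (use eq in metis)+
      also have "\<dots> = real (d - 1) * (lam 1 - lam 2)" by simp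
      finally have "lam 1 - lam 2 - S / real (d - 1) = 0" using dp by simp
      thus "G = 0" unfolding G using eq by metis
    qed
    thus ?thesis using False by simp
  qed auto
  show "lam_TDep d lam = lam 1 \<longleftrightarrow> (\<forall>i \<in> {2..d}. lam i = lam 2)"
    by (simp only: e1 e2 e3 e4)
qed

section \<open>Exceptional initial vectors\<close>

context orthonormal_eigenbasis begin

lemma col_inner_col: "i < d \<Longrightarrow> j < d \<Longrightarrow> col Q i \<bullet> col Q j = (if i = j then 1 else 0)"
  using arg_cong[OF QtQ, of "\<lambda>X. X $$ (i,j)"] Q by simp

lemma col_nonzero: "i < d \<Longrightarrow> col Q i \<noteq> 0\<^sub>v d"
  using col_inner_col[of i i] by auto

lemma AE_coord_nonzero:
  assumes "i < d" shows "AE g in std_gaussian_vec d. g \<in> carrier_vec d \<and> coord i g \<noteq> 0"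
  unfolding coord_def
  by (rule AE_std_gaussian_vec_not_orthogonal) (use Q assms col_nonzero in auto)

lemma AE_normalize_vec_coord_nonzero:
  assumes "i < d"
  shows "AE g in std_gaussian_vec d. normalize_vec g \<in> unit_sphere d \<and> coord i (normalize_vec g) \<noteq> 0"
  using AE_coord_nonzero[OF assms]
proof eventually_elim
  case (elim g)
  thus ?case using assms normalize_vec_in_unit_sphere inner_self_pos coord_normalize_vec_nonzero by blast
qed

text \<open>Writes the line as an intersection of hyperplanes, for which measurability and null
  measure are available.\<close>

lemma span_col_0:
  assumes d: "0 < d" and x: "x \<in> carrier_vec d"
  shows "(\<exists>c. x = c \<cdot>\<^sub>v col Q 0) \<longleftrightarrow> (\<forall>i\<in>{1..<d}. col Q i \<bullet> x = 0)"
proof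
  assume "\<exists>c. x = c \<cdot>\<^sub>v col Q 0"
  thus "\<forall>i\<in>{1..<d}. col Q i \<bullet> x = 0" using d Q by (auto simp: col_inner_col)
next
  assume "\<forall>i\<in>{1..<d}. col Q i \<bullet> x = 0"
  hence z: "transpose_mat Q *\<^sub>v x = (col Q 0 \<bullet> x) \<cdot>\<^sub>v unit_vec d 0"
    using Q by (intro eq_vecI) auto
  have "x = Q *\<^sub>v (transpose_mat Q *\<^sub>v x)" using x by (simp add: expansion)
  also have "\<dots> = (col Q 0 \<bullet> x) \<cdot>\<^sub>v col Q 0"
    unfolding z using Q d by (simp add: mult_mat_vec[OF Q] mat_mult_unit_vec_col)
  finally show "\<exists>c. x = c \<cdot>\<^sub>v col Q 0" by blast
qed

text \<open>The line lies in the hyperplane orthogonal to \<open>col Q 1\<close>, a column that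
  exists because of \<open>2 \<le> d\<close>. So does the truncated cone over \<open>?E\<close>,
  which is therefore Lebesgue null.\<close>

lemma line_null_sphere_measure:
  assumes d: "2 \<le> d"
  shows "{x \<in> unit_sphere d. \<exists>c. x = c \<cdot>\<^sub>v col Q 0} \<in> null_sets (sphere_measure d)" (is "?E \<in> _")
proof (rule null_setsI)
  let ?H = "\<lambda>i. {x \<in> carrier_vec d. col Q i \<bullet> x = 0}"
  \<comment> \<open>Measurability comes from the full intersection of hyperplanes; for the measure,
    the single hyperplane \<open>?H 1\<close> is enough.\<close>
  have "?E = (\<Inter>i\<in>{1..<d}. ?H i) \<inter> unit_sphere d"
    using d span_col_0 by (auto simp: unit_sphere_def)
  moreover have "(\<Inter>i\<in>{1..<d}. ?H i) \<in> sets (borel_vec d)"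
    using d Q by (intro sets.finite_INT hyperplane_in_borel_vec) auto
  ultimately show "?E \<in> sets (sphere_measure d)"
    unfolding sphere_measure_def by (auto simp: sets_restrict_space)
  define B where "B = {x :: real vec. x \<noteq> 0\<^sub>v d \<and> norm2 x \<le> 1}"
  have H: "?H 1 \<in> null_sets (lborel_vec d)"
    using d Q col_nonzero[of 1] by (intro hyperplane_null_lborel_vec) auto
  have sub: "normalize_vec -` ?E \<inter> space (restrict_space (lborel_vec d) B) \<subseteq> ?H 1"
  proof
    fix x assume x: "x \<in> normalize_vec -` ?E \<inter> space (restrict_space (lborel_vec d) B)"
    hence xc: "x \<in> carrier_vec d"
      by (auto simp: space_restrict_space lborel_vec_def borel_vec_def)
    have n: "norm2 (normalize_vec x) = 1" and c: "\<exists>c. normalize_vec x = c \<cdot>\<^sub>v col Q 0"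
      using x by (auto simp: unit_sphere_def)
    have "normalize_vec x \<in> carrier_vec d" using xc by (simp add: normalize_vec_def)
    hence "col Q 1 \<bullet> normalize_vec x = 0" using c span_col_0[of "normalize_vec x"] d by auto
    \<comment> \<open>Excludes the division by zero in \<open>normalize_vec\<close>, so that
      orthogonality passes from the normalized vector back to \<open>x\<close>.\<close>
    moreover have "norm2 x \<noteq> 0"
    proof
      assume "norm2 x = 0"
      hence "normalize_vec x = 0\<^sub>v d" using xc by (intro eq_vecI) (auto simp: normalize_vec_def)
      thus False using n by (simp add: norm2_def)
    qed
    ultimately show "x \<in> ?H 1" using xc Q by (simp add: normalize_vec_def)
  qed
  have "emeasure (distr (restrict_space (lborel_vec d) B) (restrict_space (borel_vec d) (unit_sphere d)) normalize_vec) ?E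
      \<le> emeasure (restrict_space (lborel_vec d) B) (normalize_vec -` ?E \<inter> space (restrict_space (lborel_vec d) B))"
    by (rule emeasure_distr_le)
  also have "\<dots> \<le> emeasure (lborel_vec d) (normalize_vec -` ?E \<inter> space (restrict_space (lborel_vec d) B))"
    by (rule emeasure_restrict_space_le)
  also have "\<dots> \<le> emeasure (lborel_vec d) (?H 1)"
    by (rule emeasure_mono[OF sub]) (use H in auto)
  also have "\<dots> = 0" using H by auto
  finally show "emeasure (sphere_measure d) ?E = 0"
    unfolding sphere_measure_def B_def[symmetric] by simp
qed

end

text \<open>For \<open>d = 1\<close> there is no lambda_2 and the whole sphere lies on the line of
  \<open>v1\<close>, whence the guards \<open>2 \<le> d\<close>. If all eigenvalues coincide, both
  endpoints equal lambda_1 for every \<open>q\<close>, whence the exclusion in the claim of positive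
  width.\<close>

theorem proposition5p2:
  fixes n p d :: nat and A :: "nat \<Rightarrow> real mat" and lam :: "nat \<Rightarrow> real" and v1 :: "real vec"
  assumes "1 \<le> n" and "1 \<le> p" and "d = n * p"
    and tensor: "\<forall>k \<in> {1..p}. A k \<in> carrier_mat n n"
    and "T_SPD n p A"
    and "T_eigenvalues n p A lam"
    and "\<forall>i \<in> {1..<d}. lam (i + 1) \<le> lam i" and "0 < lam d"
    and "eigenvector (bcirc n p A) v1 (lam 1)" and "norm2 v1 = 1"
  shows
    \<comment> \<open>(i)\<close>
    "((\<forall>x0 \<in> unit_sphere d. cos (angle x0 v1) \<noteq> 0 \<longrightarrow>
         (\<lambda>q. lam_pow n p A x0 q) \<longlonglongrightarrow> lam 1 \<and>
         (2 \<le> d \<longrightarrow> (\<exists>C. \<forall>q\<ge>1.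
           \<bar>lam_pow n p A x0 q - lam 1\<bar> \<le> C * (1 - spectral_gap lam) ^ (2 * q)))) \<and>
      (AE g in std_gaussian_vec d. cos (angle (normalize_vec g) v1) \<noteq> 0))
     \<and> \<comment> \<open>(ii)\<close>
     (lam_TDep d lam = lam 1 \<longleftrightarrow> (\<forall>i \<in> {2..d}. lam i = lam 2))
     \<and> \<comment> \<open>(iii)\<close>
     ((\<forall>x0 \<in> unit_sphere d. cos (angle x0 v1) \<noteq> 0 \<longrightarrow>
         ((\<lambda>q. lam_TDep d lam - lam_pow n p A x0 q) \<longlonglongrightarrow> 0 \<longleftrightarrow>
           (\<forall>i \<in> {2..d}. lam i = lam 2)) \<and>
         ((\<forall>i \<in> {2..d}. lam i = lam 2) \<longrightarrow>
           lam_TDep d lam = lam 1 \<and> (\<lambda>q. lam_pow n p A x0 q) \<longlonglongrightarrow> lam 1)) \<and>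
      (\<not> (\<forall>i \<in> {1..d}. lam i = lam 1) \<longrightarrow>
         (\<forall>q\<ge>1. AE g in std_gaussian_vec d.
           0 < lam_TDep d lam - lam_pow n p A (normalize_vec g) q)) \<and>
      (2 \<le> d \<longrightarrow>
         {x0 \<in> unit_sphere d. \<exists>c. x0 = c \<cdot>\<^sub>v v1} \<in> null_sets (sphere_measure d)))"
proof -

  \<comment> \<open>Passage from the tensor to an eigenbasis\<close>
  define M where "M = bcirc n p A"
  have d1: "1 \<le> d" using assms(1-3) by simp
  have M: "M \<in> carrier_mat d d" by (simp add: M_def bcirc_def assms(3))
  have sym: "transpose_mat M = M" using assms(5) by (simp add: T_SPD_def spd_def M_def)
  have v1: "v1 \<in> carrier_vec d" "v1 \<bullet> v1 = 1" "M *\<^sub>v v1 = lam 1 \<cdot>\<^sub>v v1"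
    using assms(9,10) M by (auto simp: eigenvector_def M_def[symmetric] norm2_def)
  \<comment> \<open>Shifts the eigenvalues to indices from 0, so that the head of the list is
    \<open>lam 1\<close>.\<close>
  define es where "es = map (\<lambda>i. lam (Suc i)) [0..<d]"
  have "char_poly M = (\<Prod>i = 1..d. [:- lam i, 1:])"
    using assms(3,6) by (simp add: T_eigenvalues_def M_def)
  also have "\<dots> = (\<Prod>i = 0..<d. [:- lam (Suc i), 1:])"
    using prod.shift_bounds_Suc_ivl[of "\<lambda>i. [:- lam i, 1:]" 0 d] by (simp add: atLeastLessThanSuc_atLeastAtMost)
  also have "\<dots> = (\<Prod>e\<leftarrow>es. [:- e, 1:])"
    by (simp add: es_def comp_def prod.distinct_set_conv_list[symmetric])
  finally have cp: "char_poly M = (\<Prod>e\<leftarrow>es. [:- e, 1:])" .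
  have "hd es = lam 1" using d1 by (simp add: es_def hd_map)
  with spectral_theorem_real_symmetric[OF M sym _ cp, of v1] obtain Q where
    Q_props: "Q \<in> carrier_mat d d" "transpose_mat Q * Q = 1\<^sub>m d" "M * Q = Q * mat_diag d (\<lambda>i. es ! i)"
      "Q *\<^sub>v unit_vec d 0 = v1"
    using v1 d1 by (auto simp: es_def)
  have "mat_diag d (\<lambda>i. es ! i) = mat_diag d (\<lambda>i. lam (Suc i))"
    by (rule eq_matI) (auto simp: mat_diag_def es_def)
  then interpret orthonormal_eigenbasis d M Q "\<lambda>i. lam (Suc i)"
    using M Q_props by unfold_locales simp_all
  \<comment> \<open>Coordinate 0 is thus the component along the given \<open>v1\<close>, even if
    lambda_1 is a multiple eigenvalue.\<close>
  have col0: "col Q 0 = v1" using Q_props(1,4) d1 by (simp add: mat_mult_unit_vec_col)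
  have anti: "lam j \<le> lam i" if "1 \<le> i" "i \<le> j" "j \<le> d" for i j
    using that(2,3)
  proof (induction j rule: dec_induct)
    case (step k)
    have "lam (k + 1) \<le> lam k" using assms(7) step that(1) by auto
    thus ?case using step by simp
  qed simp
  have pos: "0 < lam (Suc i)" if "i < d" for i
    using anti[of "Suc i" d] assms(8) that by simp
  have top: "lam (Suc i) \<le> lam (Suc 0)" if "i < d" for i using anti[of 1 "Suc i"] that by simp
  have top': "lam i \<le> lam 1" if "i \<in> {1..d}" for i using anti[of 1 i] that by simp

  \<comment> \<open>Convergence and rate of the lower endpoint\<close>
  have pw: "lam_pow n p A x q = power_iterate M x q \<bullet> (M *\<^sub>v power_iterate M x q)" for x q
    by (simp add: lam_pow_def M_def)
  have ang: "cos (angle x v1) \<noteq> 0 \<longleftrightarrow> coord 0 x \<noteq> 0" if "x \<in> unit_sphere d" for x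
    using cos_angle[OF that, of 0] d1 by (simp add: col0)
  have lim: "(\<lambda>q. lam_pow n p A x q) \<longlonglongrightarrow> lam 1" if "x \<in> unit_sphere d" "cos (angle x v1) \<noteq> 0" for x
    using power_rayleigh_tendsto[OF that(1) pos top] ang[OF that(1)] that d1 by (simp add: pw)
  have rate: "\<exists>C. \<forall>q\<ge>1. \<bar>lam_pow n p A x q - lam 1\<bar> \<le> C * (1 - spectral_gap lam) ^ (2 * q)"
    if x: "x \<in> unit_sphere d" "cos (angle x v1) \<noteq> 0" for x
  proof -
    have second: "lam (Suc i) \<le> lam 2" if "0 < i" "i < d" for i using anti[of 2 "Suc i"] that by simp
    have d0: "0 < d" and c0: "coord 0 x \<noteq> 0" using d1 x ang[OF x(1)] by simp_all
    have "\<bar>power_iterate M x q \<bullet> (M *\<^sub>v power_iterate M x q) - lam (Suc 0)\<bar>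
        \<le> (\<Sum>i<d. (lam (Suc 0) - lam (Suc i)) * (coord i x / coord 0 x)\<^sup>2)
          * (lam 2 / lam (Suc 0)) ^ (2 * q)" for q
      by (rule power_rayleigh_rate[OF x(1) _ _ d0 c0]) (rule pos top second; assumption)+
    moreover have "1 - spectral_gap lam = lam 2 / lam (Suc 0)" by (simp add: spectral_gap_def)
    ultimately have "\<bar>lam_pow n p A x q - lam 1\<bar> \<le> (\<Sum>i<d. (lam (Suc 0) - lam (Suc i)) *
        (coord i x / coord 0 x)\<^sup>2) * (1 - spectral_gap lam) ^ (2 * q)" for q
      by (simp only: pw One_nat_def)
    thus ?thesis by blast
  qed

  \<comment> \<open>Upper endpoint and bracket width\<close>
  have ii: "lam_TDep d lam = lam 1 \<longleftrightarrow> (\<forall>i \<in> {2..d}. lam i = lam 2)"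
    by (rule lam_TDep_eq_iff[OF d1]) (rule top')
  have ge: "lam 1 \<le> lam_TDep d lam" by (rule lam_TDep_ge[OF d1]) (rule top')
  have width: "(\<lambda>q. lam_TDep d lam - lam_pow n p A x q) \<longlonglongrightarrow> 0 \<longleftrightarrow> (\<forall>i \<in> {2..d}. lam i = lam 2)"
    if "x \<in> unit_sphere d" "cos (angle x v1) \<noteq> 0" for x
  proof -
    \<comment> \<open>The width always converges, so by uniqueness of limits its tending to zero is
      the equality case of the upper endpoint.\<close>
    have "(\<lambda>q. lam_TDep d lam - lam_pow n p A x q) \<longlonglongrightarrow> lam_TDep d lam - lam 1"
      by (intro tendsto_diff tendsto_const lim that)
    thus ?thesis unfolding ii[symmetric] by (metis LIMSEQ_unique right_minus_eq)
  qed

  \<comment> \<open>Almost sure statements\<close>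
  have ae: "AE g in std_gaussian_vec d. cos (angle (normalize_vec g) v1) \<noteq> 0"
    using AE_normalize_vec_coord_nonzero[of 0] d1 ang by (auto elim: eventually_mono)
  have strict: "AE g in std_gaussian_vec d. 0 < lam_TDep d lam - lam_pow n p A (normalize_vec g) q"
    if "\<not> (\<forall>i \<in> {1..d}. lam i = lam 1)" for q
  proof -
    obtain i where i: "i \<in> {1..d}" "lam i \<noteq> lam 1" using \<open>\<not> _\<close> by blast
    \<comment> \<open>Unless all eigenvalues agree, the smallest one is strictly below lambda_1. Its
      coordinate has index \<open>d - 1\<close> and is almost surely nonzero. Avoiding the line of
      \<open>v1\<close> alone would not do: if lambda_1 is multiple, its other eigenvectors also
      attain it.\<close>
    have less: "lam (Suc (d - 1)) < lam (Suc 0)" using i top'[of i] anti[of i d] d1 by simp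
    have "AE g in std_gaussian_vec d. normalize_vec g \<in> unit_sphere d \<and> coord (d - 1) (normalize_vec g) \<noteq> 0"
      using d1 by (intro AE_normalize_vec_coord_nonzero) simp
    thus ?thesis
    proof eventually_elim
      case (elim g)
      hence "lam_pow n p A (normalize_vec g) q < lam 1"
        using power_rayleigh_less[OF _ pos top, of "normalize_vec g" "d - 1" q] d1 less by (simp add: pw)
      thus ?case using ge by simp
    qed
  qed
  have sphere: "2 \<le> d \<Longrightarrow> {x0 \<in> unit_sphere d. \<exists>c. x0 = c \<cdot>\<^sub>v v1} \<in> null_sets (sphere_measure d)"
    using line_null_sphere_measure by (simp add: col0)
  show ?thesis
    by (intro conjI ballI impI allI)
      (assumption | rule lim rate ae ii width strict sphere ii[THEN iffD2])+
qed

end
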